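(* If $Q$ is a Jordan loop of order $9$, then $Q$ is a group (i.e. its multiplication is associative).
   Context: A loop is a set $Q$ with a binary operation $\cdot$ (written by juxtaposition) and a neutral element $e$ such that for all $a,b\in Q$ the equations $ax=b$ and $ya=b$ have unique solutions $x,y\in Q$. A Jordan loop is a commutative loop satisfying the Jordan identity $x^2(yx)=(x^2y)x$ for all $x,y$, where $x^2=xx$. *)

theory Defs
  imports Main
begin

definition loop :: "'a set \<Rightarrow> ('a \<Rightarrow> 'a \<Rightarrow> 'a) \<Rightarrow> 'a \<Rightarrow> bool" where
  "loop Q mult e \<longleftrightarrow>
     (\<forall>a\<in>Q. \<forall>b\<in>Q. mult a b \<in> Q) \<and> e \<in> Q \<and>
     (\<forall>a\<in>Q. mult e a = a \<and> mult a e = a) \<and>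
     (\<forall>a\<in>Q. \<forall>b\<in>Q. (\<exists>!x. x \<in> Q \<and> mult a x = b) \<and> (\<exists>!y. y \<in> Q \<and> mult y a = b))"

definition jordan_loop :: "'a set \<Rightarrow> ('a \<Rightarrow> 'a \<Rightarrow> 'a) \<Rightarrow> 'a \<Rightarrow> bool" where
  "jordan_loop Q mult e \<longleftrightarrow>
     loop Q mult e \<and>
     (\<forall>a\<in>Q. \<forall>b\<in>Q. mult a b = mult b a) \<and>
     (\<forall>x\<in>Q. \<forall>y\<in>Q. mult (mult x x) (mult y x) = mult (mult (mult x x) y) x)"

end

theory Submission
  imports Defs "HOL-Number_Theory.Cong"
begin

text \<open>
  In odd order every element has a unique square root, because the solutions of \<open>yz = c\<close> are paired
  off by \<open>(y, z) \<mapsto> (z, y)\<close>. For \<open>x \<noteq> e\<close> the translation by \<open>x\<^sup>2\<close> commutes with the translation \<open>a\<close>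
  by \<open>x\<close> and agrees with \<open>a\<^sup>2\<close> on the cycle of \<open>e\<close> under \<open>a\<close>. If this cycle has length \<open>k < 9\<close>, a point
  \<open>y\<close> outside it gives three distinct points \<open>y, xy, x\<^sup>2y\<close> outside it, so \<open>2 \<le> k \<le> 6\<close>. Unique square roots
  exclude \<open>k = 2, 4, 6\<close>, and \<open>k = 5\<close> would give a subloop of order \<open>5 > 9/2\<close>. If \<open>k = 9\<close> for some
  \<open>x\<close>, repeated doubling of exponents shows that \<open>Q\<close> is cyclic. Otherwise \<open>x\<^sup>2\<close> is an inverse of \<open>x\<close> for
  every \<open>x\<close>, and then \<open>Q\<close> has the multiplication of the elementary abelian group: for independent
  \<open>x, y\<close> the four products \<open>x\<^sup>\<plusminus>\<^sup>1y\<^sup>\<plusminus>\<^sup>1\<close> are distinct, so together with \<open>e, x\<^sup>\<plusminus>\<^sup>1, y\<^sup>\<plusminus>\<^sup>1\<close> they exhaust \<open>Q\<close>.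
\<close>

section \<open>Involutions on sets of odd size\<close>

lemma involution_fixpoint_of_odd_card:
  assumes "finite A" "odd (card A)"
    and "\<And>x. x \<in> A \<Longrightarrow> f x \<in> A" "\<And>x. x \<in> A \<Longrightarrow> f (f x) = x"
  shows "\<exists>x\<in>A. f x = x"
  using assms
proof (induction "card A" arbitrary: A rule: less_induct)
  case less
  obtain a where a: "a \<in> A"
    using less.prems(2) by fastforce
  show ?case
  proof (cases "f a = a")
    case False
    let ?B = "A - {a, f a}"
    have card: "card A = card ?B + 2"
      using False a less.prems card_Diff_subset[of "{a, f a}" A]
        card_mono[of A "{a, f a}"] by auto
    \<comment> \<open>Removing a 2-element orbit leaves an \<open>f\<close>-invariant set, again of
      odd size.\<close>
    have "f x \<in> ?B" if "x \<in> ?B" for x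
      using that less.prems(3,4) a by (metis Diff_iff insert_iff empty_iff)
    then have "\<exists>x\<in>?B. f x = x"
      using less.hyps[of ?B] less.prems card by auto
    then show ?thesis by blast
  qed (use a in blast)
qed

section \<open>Cancellation and unique square roots\<close>

locale jordan_loop_9 =
  fixes Q :: "'a set" and mult :: "'a \<Rightarrow> 'a \<Rightarrow> 'a" (infixl "\<cdot>" 70) and e :: 'a
  assumes jordan_loop: "jordan_loop Q mult e"
    and fin: "finite Q" and card9: "card Q = 9"
begin

definition sq :: "'a \<Rightarrow> 'a" where
  "sq x = x \<cdot> x"

lemma closed [simp, intro]: "x \<in> Q \<Longrightarrow> y \<in> Q \<Longrightarrow> x \<cdot> y \<in> Q"
  and e_closed [simp, intro]: "e \<in> Q"
  and e_left [simp]: "x \<in> Q \<Longrightarrow> e \<cdot> x = x"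
  and e_right [simp]: "x \<in> Q \<Longrightarrow> x \<cdot> e = x"
  and division: "x \<in> Q \<Longrightarrow> y \<in> Q \<Longrightarrow> \<exists>!z. z \<in> Q \<and> x \<cdot> z = y"
  and comm: "x \<in> Q \<Longrightarrow> y \<in> Q \<Longrightarrow> x \<cdot> y = y \<cdot> x"
  using jordan_loop unfolding jordan_loop_def loop_def by simp_all

lemma sq_closed [simp, intro]: "x \<in> Q \<Longrightarrow> sq x \<in> Q"
  by (simp add: sq_def)

lemma sq_e [simp]: "sq e = e"
  by (simp add: sq_def)

lemma cancel [simp]: "x \<in> Q \<Longrightarrow> y \<in> Q \<Longrightarrow> z \<in> Q \<Longrightarrow> x \<cdot> y = x \<cdot> z \<longleftrightarrow> y = z"
  using division[of x "x \<cdot> z"] by blast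

lemma cancel_right [simp]: "x \<in> Q \<Longrightarrow> y \<in> Q \<Longrightarrow> z \<in> Q \<Longrightarrow> y \<cdot> x = z \<cdot> x \<longleftrightarrow> y = z"
  using cancel comm by metis

lemma mult_eq_self [simp]:
  assumes "x \<in> Q" "y \<in> Q"
  shows "x \<cdot> y = x \<longleftrightarrow> y = e" and "x \<cdot> y = y \<longleftrightarrow> x = e"
    and "x = x \<cdot> y \<longleftrightarrow> y = e" and "y = x \<cdot> y \<longleftrightarrow> x = e"
proof -
  show "x \<cdot> y = x \<longleftrightarrow> y = e" and "x \<cdot> y = y \<longleftrightarrow> x = e"
    using assms cancel[of x y e] cancel_right[of y x e] by simp_all
  then show "x = x \<cdot> y \<longleftrightarrow> y = e" and "y = x \<cdot> y \<longleftrightarrow> x = e"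
    by metis+
qed

lemma jordan: "x \<in> Q \<Longrightarrow> y \<in> Q \<Longrightarrow> sq x \<cdot> (x \<cdot> y) = x \<cdot> (sq x \<cdot> y)"
  using jordan_loop comm closed unfolding jordan_loop_def sq_def by metis

text \<open>The Jordan identity at \<open>y = x\<close>; it fixes one bracketing of the fourth
  power.\<close>

lemma sq_sq: "x \<in> Q \<Longrightarrow> sq (sq x) = x \<cdot> (x \<cdot> sq x)"
  using jordan[of x x] comm[of x "sq x"] by (simp add: sq_def)

lemma inj_on_sq: "inj_on sq Q"
proof -
  have "c \<in> sq ` Q" if c: "c \<in> Q" for c
  proof -
    \<comment> \<open>Commutativity makes division into \<open>c\<close> an involution; its fixed
      points are the square roots of \<open>c\<close>.\<close>
    define f where "f y = (THE z. z \<in> Q \<and> y \<cdot> z = c)" for y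
    have f: "f y \<in> Q \<and> y \<cdot> f y = c" if "y \<in> Q" for y
      unfolding f_def by (rule theI') (rule division[OF that c])
    moreover have "f (f y) = y" if "y \<in> Q" for y
      using f comm cancel that by metis
    ultimately obtain y where "y \<in> Q" "f y = y"
      using involution_fixpoint_of_odd_card[of Q f] fin card9 by auto
    then show ?thesis using f sq_def by (metis imageI)
  qed
  then have "sq ` Q = Q" by auto
  then show ?thesis using fin by (simp add: eq_card_imp_inj_on)
qed

lemma sq_inject [simp]: "x \<in> Q \<Longrightarrow> y \<in> Q \<Longrightarrow> sq x = sq y \<longleftrightarrow> x = y"
  using inj_on_sq by (auto dest: inj_onD)

lemma sq_eq_e [simp]:
  assumes "x \<in> Q"
  shows "sq x = e \<longleftrightarrow> x = e" and "e = sq x \<longleftrightarrow> x = e"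
  using sq_inject[of x e] sq_inject[of e x] assms by auto

lemma sq_eq_self [simp]: "x \<in> Q \<Longrightarrow> sq x = x \<longleftrightarrow> x = e" "x \<in> Q \<Longrightarrow> x = sq x \<longleftrightarrow> x = e"
  by (simp_all add: sq_def)

section \<open>Powers as iterated translations, and their period\<close>

definition pow :: "'a \<Rightarrow> nat \<Rightarrow> 'a" where
  "pow x n = ((\<cdot>) x ^^ n) e"

lemma pow_0 [simp]: "pow x 0 = e"
  and pow_Suc: "pow x (Suc n) = x \<cdot> pow x n"
  by (simp_all add: pow_def)

lemma pow_closed [simp, intro]: "x \<in> Q \<Longrightarrow> pow x n \<in> Q"
  by (induction n) (simp_all add: pow_Suc)

lemma pow_1 [simp]: "x \<in> Q \<Longrightarrow> pow x (Suc 0) = x"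
  by (simp add: pow_Suc)

lemma pow_2: "x \<in> Q \<Longrightarrow> pow x 2 = sq x"
  by (simp add: pow_Suc numeral_2_eq_2 sq_def)

lemma pow_add_cancel: "x \<in> Q \<Longrightarrow> pow x (i + n) = pow x (j + n) \<longleftrightarrow> pow x i = pow x j"
  by (induction n) (simp_all add: pow_Suc)

definition period :: "'a \<Rightarrow> nat" where
  "period x = (LEAST k. 0 < k \<and> pow x k = e)"

lemma period:
  assumes "x \<in> Q"
  shows period_pos: "0 < period x" and pow_period: "pow x (period x) = e"
proof -
  \<comment> \<open>Pigeonhole gives two equal powers; cancelling common factors brings the
    repetition down to \<open>e\<close>, so the \<open>LEAST\<close> in \<open>period\<close>
    exists.\<close>
  have "\<not> inj (pow x)"
    using assms fin finite_subset[of "range (pow x)" Q] finite_imageD[of "pow x" UNIV] by auto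
  then obtain i j where "i < j" "pow x i = pow x j"
    unfolding inj_def by (metis linorder_neqE_nat)
  then have "0 < j - i \<and> pow x (j - i) = e"
    using pow_add_cancel[OF assms, of "j - i" i 0] by simp
  from LeastI[where P = "\<lambda>k. 0 < k \<and> pow x k = e", OF this]
  show "0 < period x" and "pow x (period x) = e"
    by (simp_all add: period_def)
qed

lemma pow_ne_e: "0 < n \<Longrightarrow> n < period x \<Longrightarrow> pow x n \<noteq> e"
  using not_less_Least[of n "\<lambda>k. 0 < k \<and> pow x k = e"] by (auto simp: period_def)

lemma pow_mod_period: "x \<in> Q \<Longrightarrow> pow x (n mod period x) = pow x n"
proof (induction n rule: less_induct)
  case (less n)
  show ?case
  proof (cases "n < period x")
    case False
    then have "pow x n = pow x (n - period x)"
      using pow_add_cancel[of x "period x" "n - period x" 0] less.prems pow_period by simp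
    moreover have "n mod period x = (n - period x) mod period x"
      using False by (simp add: le_mod_geq)
    ultimately show ?thesis
      using less False period_pos[of x] by simp
  qed simp
qed

lemma pow_cong: "x \<in> Q \<Longrightarrow> [m = n] (mod period x) \<Longrightarrow> pow x m = pow x n"
  using pow_mod_period unfolding cong_def by metis

lemma inj_on_pow:
  assumes "x \<in> Q"
  shows "inj_on (pow x) {..<period x}"
proof (rule linorder_inj_onI)
  fix i j assume "i < j" "j \<in> {..<period x}"
  then show "pow x i \<noteq> pow x j"
    using pow_add_cancel[OF assms, of "j - i" i 0] pow_ne_e[of "j - i" x] by fastforce
qed auto

text \<open>The orbit of \<open>e\<close> under translation by \<open>x\<close>; a priori it need
  not be closed under the product.\<close>

definition cycle :: "'a \<Rightarrow> 'a set" where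
  "cycle x = range (pow x)"

lemma cycle_eq: "x \<in> Q \<Longrightarrow> cycle x = pow x ` {..<period x}"
  unfolding cycle_def using pow_mod_period period_pos
  by (auto simp: image_iff) (metis lessThan_iff mod_less_divisor)

lemma card_cycle: "x \<in> Q \<Longrightarrow> card (cycle x) = period x"
  by (simp add: cycle_eq card_image inj_on_pow)

lemma cycle_subset: "x \<in> Q \<Longrightarrow> cycle x \<subseteq> Q"
  by (auto simp: cycle_def)

section \<open>Translations that rotate the cycle\<close>

definition shift :: "'a \<Rightarrow> nat \<Rightarrow> bool" where
  "shift x m \<longleftrightarrow> (\<forall>n. pow x m \<cdot> pow x n = pow x (m + n))"

lemma shift_0: "x \<in> Q \<Longrightarrow> shift x 0"
  by (simp add: shift_def)

lemma shift_1: "x \<in> Q \<Longrightarrow> shift x 1"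
  by (simp add: shift_def pow_Suc)

lemma shift_cong: "x \<in> Q \<Longrightarrow> [m = n] (mod period x) \<Longrightarrow> shift x m \<Longrightarrow> shift x n"
  unfolding shift_def using pow_cong cong_add_rcancel_nat by metis

text \<open>The translation by \<open>x\<^sup>2\<^sup>m\<close> commutes with the translation by \<open>x\<^sup>m\<close>, whose powers move \<open>e\<close> to every
  point of the cycle when \<open>m\<close> is prime to the period.\<close>

lemma shift_double:
  assumes x: "x \<in> Q" and m: "shift x m" and cop: "coprime m (period x)"
  shows "shift x (2 * m)"
proof -
  have sq: "sq (pow x m) = pow x (2 * m)"
    using m by (simp add: sq_def shift_def mult_2)
  have *: "pow x (2 * m) \<cdot> pow x (m * j) = pow x (2 * m + m * j)" for j
  proof (induction j)
    case (Suc j)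
    have "pow x (2 * m) \<cdot> pow x (m * Suc j) = sq (pow x m) \<cdot> (pow x m \<cdot> pow x (m * j))"
      using m by (simp add: sq shift_def)
    also have "\<dots> = pow x m \<cdot> (pow x (2 * m) \<cdot> pow x (m * j))"
      using x jordan[of "pow x m" "pow x (m * j)"] by (simp add: sq)
    also have "\<dots> = pow x (2 * m + m * Suc j)"
      using m unfolding Suc shift_def by (simp add: algebra_simps)
    finally show ?case .
  qed (use x in simp)
  show ?thesis
    unfolding shift_def
  proof
    fix n
    \<comment> \<open>As \<open>m\<close> is invertible modulo the period, every exponent is
      congruent to a multiple of \<open>m\<close>, where \<open>*\<close> applies.\<close>
    obtain i where "[m * i = 1] (mod period x)"
      using cong_solve_coprime_nat[OF cop] by auto
    then have "[m * (i * n) = n] (mod period x)"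
      using cong_scalar_right[of "m * i" 1 "period x" n] by (simp add: mult.assoc)
    then show "pow x (2 * m) \<cdot> pow x n = pow x (2 * m + n)"
      using *[of "i * n"] pow_cong[OF x] cong_add_lcancel_nat by metis
  qed
qed

lemma shift_2: "x \<in> Q \<Longrightarrow> shift x 2"
  using shift_double[OF _ shift_1] by simp

text \<open>Translation by \<open>pow x m\<close> permutes the cycle, so by cancellation it cannot
  bring an outside point in.\<close>

lemma mult_notin_cycle:
  assumes "x \<in> Q" "y \<in> Q - cycle x" "shift x m"
  shows "pow x m \<cdot> y \<notin> cycle x"
proof
  assume "pow x m \<cdot> y \<in> cycle x"
  then obtain n where n: "pow x m \<cdot> y = pow x n"
    by (auto simp: cycle_def)
  \<comment> \<open>The term \<open>(period x - 1) * m\<close> plays the role of the exponent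
    \<open>-m\<close>.\<close>
  have eq: "m + (n + (period x - 1) * m) = n + period x * m"
    using period_pos[OF assms(1)] by (cases "period x") auto
  then have "pow x (m + (n + (period x - 1) * m)) = pow x n"
    unfolding eq by (intro pow_cong[OF assms(1)]) (simp add: cong_def)
  then have "pow x m \<cdot> y = pow x m \<cdot> pow x (n + (period x - 1) * m)"
    using n assms(3) by (simp add: shift_def)
  then have "y = pow x (n + (period x - 1) * m)"
    using assms by simp
  then show False
    using assms(2) by (auto simp: cycle_def)
qed

section \<open>Excluding periods other than 3 and 9\<close>

lemma period_cases:
  assumes x: "x \<in> Q" and xe: "x \<noteq> e"
  shows "period x = 3 \<or> period x = 9"
proof (rule ccontr)
  assume contra: "\<not> ?thesis"
  let ?k = "period x"
  have "cycle x \<noteq> Q"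
    using contra card_cycle[OF x] card9 by auto
  then obtain y where y: "y \<in> Q - cycle x"
    using cycle_subset[OF x] by blast
  have "x \<noteq> sq x" "sq x \<noteq> e"
    using x xe by simp_all
  then have "x \<cdot> y \<noteq> y" "sq x \<cdot> y \<noteq> y" "x \<cdot> y \<noteq> sq x \<cdot> y"
    using x xe y by simp_all
  then have "card {y, x \<cdot> y, sq x \<cdot> y} = 3"
    unfolding card_3_iff by metis
  moreover have "{y, x \<cdot> y, sq x \<cdot> y} \<subseteq> Q - cycle x"
    using x y mult_notin_cycle[OF x y shift_1] mult_notin_cycle[OF x y shift_2] pow_2[OF x]
    by auto
  ultimately have "3 \<le> card (Q - cycle x)"
    using card_mono fin by (metis finite_Diff)
  then have "?k \<le> 6"
    using x card9 by (simp add: card_Diff_subset finite_subset[OF _ fin] cycle_subset card_cycle)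
  moreover have "?k \<noteq> 1" "?k \<noteq> 2"
    using pow_period[OF x] xe x by (auto simp: pow_2)
  \<comment> \<open>With period 4, both \<open>sq x\<close> and then \<open>x\<close> would be
    square roots of \<open>e\<close>.\<close>
  moreover have sq_pow2: "sq (pow x 2) = pow x 4"
    using shift_2[OF x] by (simp add: shift_def sq_def)
  then have "?k \<noteq> 4"
    using pow_period[OF x] xe x by (auto simp: pow_2)
  moreover have "?k \<noteq> 6"
  proof
    assume k: "?k = 6"
    have "pow x 2 \<cdot> pow x 4 = e"
      using shift_2[OF x] pow_period[OF x] k by (simp add: shift_def)
    \<comment> \<open>By \<open>sq_sq\<close> at \<open>pow x 2\<close>. Now \<open>pow x 4\<close>
      and \<open>x\<close> have the same square, so they coincide, which period 6 forbids.\<close>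
    then have "sq (pow x 4) = pow x 2"
      using sq_sq[of "pow x 2"] sq_pow2 x by simp
    then have "pow x 4 = pow x 1"
      using x by (simp add: pow_2)
    then show False
      using inj_on_pow[OF x] k by (auto dest: inj_onD)
  qed
  moreover have "?k \<noteq> 5"
  proof
    assume k: "?k = 5"
    have c: "coprime m (5::nat)" if "m = 2 \<or> m = 4" for m
      using that by (auto intro!: gcd_eq_1_imp_coprime simp: gcd_non_0_nat)
    \<comment> \<open>Doubling runs through 1, 2, 4, 8 = 3 modulo 5, so all points of the cycle send
      \<open>y\<close> outside: five distinct images for four places.\<close>
    have "shift x 4"
      using shift_double[OF x shift_2[OF x]] k c by simp
    moreover have "shift x 3"
      using shift_double[OF x \<open>shift x 4\<close>] k c shift_cong[OF x, of 8 3] by (simp add: cong_def)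
    ultimately have "shift x m" if "m < 5" for m
      using that shift_0[OF x] shift_1[OF x] shift_2[OF x]
      by (auto simp: less_Suc_eq numeral_eq_Suc)
    then have "pow x m \<cdot> y \<notin> cycle x" if "m < 5" for m
      using mult_notin_cycle[OF x y] that by blast
    then have "(\<lambda>z. z \<cdot> y) ` cycle x \<subseteq> Q - cycle x"
      using x y k by (auto simp: cycle_eq)
    then have "card ((\<lambda>z. z \<cdot> y) ` cycle x) \<le> card (Q - cycle x)"
      by (rule card_mono[OF finite_Diff[OF fin]])
    moreover have "inj_on (\<lambda>z. z \<cdot> y) (cycle x)"
      using cycle_subset[OF x] y by (intro inj_onI) (simp add: subset_eq)
    ultimately show False
      using x k card9
      by (simp add: card_image card_Diff_subset finite_subset[OF _ fin] cycle_subset card_cycle)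
  qed
  ultimately show False
    using contra period_pos[OF x] by linarith
qed

lemma cube_eq_e:
  assumes "x \<in> Q" "period x \<noteq> 9"
  shows "x \<cdot> sq x = e"
proof (cases "x = e")
  case False
  then have "pow x 3 = e"
    using period_cases assms pow_period by metis
  then show ?thesis
    using assms by (simp add: pow_Suc numeral_3_eq_3 sq_def)
qed simp

section \<open>The cyclic case\<close>

lemma assoc_of_period_9:
  assumes x: "x \<in> Q" and k: "period x = 9" and "u \<in> Q" "v \<in> Q" "w \<in> Q"
  shows "(u \<cdot> v) \<cdot> w = u \<cdot> (v \<cdot> w)"
proof -
  have Q: "Q = cycle x"
    using cycle_subset[OF x] card_cycle[OF x] k card9 fin by (metis card_subset_eq)
  have inj: "pow x i = pow x j \<longleftrightarrow> i = j" if "i < 9" "j < 9" for i j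
    using inj_on_pow[OF x] k that by (auto dest: inj_onD)
  have cop: "coprime m (9::nat)" if "m \<in> {2, 4, 8, 7}" for m
    using that by (auto intro!: gcd_eq_1_imp_coprime simp: gcd_non_0_nat)
  \<comment> \<open>Doubling runs through the units 1, 2, 4, 8, 7, 5 modulo 9. Only products with
    both exponents in \<open>{3, 6}\<close> then remain open.\<close>
  have s4: "shift x 4"
    using shift_double[OF x shift_2[OF x]] k cop by simp
  have s8: "shift x 8"
    using shift_double[OF x s4] k cop by simp
  have s7: "shift x 7"
    using shift_double[OF x s8] k cop shift_cong[OF x, of 16 7] by (simp add: cong_def)
  have s5: "shift x 5"
    using shift_double[OF x s7] k cop shift_cong[OF x, of 14 5] by (simp add: cong_def)
  have s: "shift x m" if "m \<in> {0, 1, 2, 4, 5, 7, 8}" for m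
    using that shift_0[OF x] shift_1[OF x] shift_2[OF x] s4 s5 s7 s8 by auto
  have sh: "pow x m \<cdot> pow x n = pow x ((m + n) mod 9)" if "m \<in> {0, 1, 2, 4, 5, 7, 8}" for m n
    using s[OF that] pow_mod_period[OF x, of "m + n"] k by (simp add: shift_def)
  have mult_pow: "pow x m \<cdot> pow x n = pow x ((m + n) mod 9)"
    if "m < 9" "n < 9" for m n
  proof (cases "m \<in> {3, 6} \<and> n \<in> {3, 6}")
    case False
    then have "m \<in> {0, 1, 2, 4, 5, 7, 8} \<or> n \<in> {0, 1, 2, 4, 5, 7, 8}"
      using that unfolding insert_iff empty_iff by presburger
    then show ?thesis
      using sh[of m n] sh[of n m] comm[of "pow x m" "pow x n"] x by (auto simp: add.commute)
  next
    case True
    \<comment> \<open>Row \<open>m\<close> of the table, written on exponents, is a permutation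
      \<open>f\<close> known except at 3 and 6. Two values are left, one of them 3 or 6 itself;
      \<open>f j \<noteq> j\<close> decides which goes where.\<close>
    have "\<exists>f. \<forall>j. f j < 9 \<and> pow x m \<cdot> pow x j = pow x (f j)"
    proof (rule choice, rule allI)
      fix j
      have "pow x m \<cdot> pow x j \<in> pow x ` {..<9}"
        using Q cycle_eq[OF x] k x by (metis closed pow_closed)
      then show "\<exists>i. i < 9 \<and> pow x m \<cdot> pow x j = pow x i"
        by auto
    qed
    then obtain f where f: "f j < 9" "pow x m \<cdot> pow x j = pow x (f j)" for j
      by blast
    have f_inj: "f i = f j \<longleftrightarrow> i = j" if "i < 9" "j < 9" for i j
      using f cancel[of "pow x m" "pow x i" "pow x j"] pow_closed[OF x] inj that by metis
    have f_sh: "f j = (m + j) mod 9" if "j \<in> {0, 1, 2, 4, 5, 7, 8}" for j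
      using sh[OF that, of m] comm[of "pow x m" "pow x j"] f(2)[of j] f(1)[of j] x inj
      by (simp add: add.commute)
    have f_ne: "f j \<noteq> j" for j
    proof
      assume "f j = j"
      then have "pow x m = e"
        using f(2)[of j] x mult_eq_self(2)[of "pow x m" "pow x j"] by simp
      then show False
        using True inj[of m 0] by auto
    qed
    have "f 3 \<noteq> (m + j) mod 9 \<and> f 6 \<noteq> (m + j) mod 9" if "j \<in> {0, 1, 2, 4, 5, 7, 8}" for j
      using f_inj[of 3 j] f_inj[of 6 j] f_sh[OF that] that by auto
    then have "\<forall>j\<in>{0, 1, 2, 4, 5, 7, 8}. f 3 \<noteq> (m + j) mod 9 \<and> f 6 \<noteq> (m + j) mod 9"
      by blast
    then have "f n = (m + n) mod 9"
      using True f(1)[of 3] f(1)[of 6] f_inj[of 3 6] f_ne[of 3] f_ne[of 6] by auto presburger+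
    then show ?thesis
      using f(2)[of n] by simp
  qed
  have mult_pow': "pow x m \<cdot> pow x n = pow x (m + n)" for m n
    using mult_pow[of "m mod 9" "n mod 9"] pow_mod_period[OF x] k by (simp add: mod_add_eq)
  obtain i j l where "u = pow x i" "v = pow x j" "w = pow x l"
    using assms Q by (auto simp: cycle_def)
  then show ?thesis
    by (simp add: mult_pow' add.assoc)
qed

end

section \<open>Exponent 3: lines and independent pairs\<close>

locale jordan_loop_9_exponent_3 = jordan_loop_9 +
  assumes cube: "x \<in> Q \<Longrightarrow> x \<cdot> sq x = e"
begin

lemma cube' [simp]: "x \<in> Q \<Longrightarrow> x \<cdot> sq x = e" "x \<in> Q \<Longrightarrow> sq x \<cdot> x = e"
  using cube comm by auto

lemma sq_sq_eq [simp]: "x \<in> Q \<Longrightarrow> sq (sq x) = x"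
  by (simp add: sq_sq)

lemma mult_eq_e: "x \<in> Q \<Longrightarrow> y \<in> Q \<Longrightarrow> x \<cdot> y = e \<longleftrightarrow> y = sq x"
  using cancel[of x y "sq x"] by simp

lemma mult_eq_sq:
  assumes "x \<in> Q" "y \<in> Q"
  shows "x \<cdot> y = sq x \<longleftrightarrow> y = x" and "x \<cdot> y = sq y \<longleftrightarrow> x = y"
  using assms cancel[of x y x] cancel_right[of y x y] by (simp_all add: sq_def)

text \<open>Linear independence over the field with three elements: the lines
  \<open>{e, x, sq x}\<close> and \<open>{e, y, sq y}\<close> are nontrivial and meet only in
  \<open>e\<close>.\<close>

definition indep :: "'a \<Rightarrow> 'a \<Rightarrow> bool" where
  "indep x y \<longleftrightarrow> x \<in> Q \<and> y \<in> Q \<and> x \<noteq> e \<and> y \<noteq> e \<and> x \<noteq> y \<and> y \<noteq> sq x"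

lemma indepD:
  assumes "indep x y"
  shows "x \<in> Q" "y \<in> Q" "x \<noteq> e" "y \<noteq> e" "x \<noteq> y" "y \<noteq> x" "y \<noteq> sq x" "sq x \<noteq> y"
    "x \<noteq> sq y" "sq y \<noteq> x"
  using assms by (auto simp: indep_def)

lemma indep_sym: "indep x y \<Longrightarrow> indep y x"
  by (auto simp: indep_def)

lemma indep_sq: "indep x y \<Longrightarrow> indep (sq x) y" "indep x y \<Longrightarrow> indep x (sq y)"
  by (auto simp: indep_def)

text \<open>The values \<open>e\<close>, \<open>x\<close>, \<open>sq x\<close> already occur in the
  row of \<open>x\<close> as its products with \<open>sq x\<close>, \<open>e\<close>,
  \<open>x\<close>; likewise for \<open>y\<close>.\<close>

lemma mult_notin:
  assumes "indep x y"
  shows "x \<cdot> y \<notin> {e, x, sq x, y, sq y}"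
  using indepD[OF assms] by (auto simp: mult_eq_e mult_eq_sq)

lemma indep_mult: "indep x y \<Longrightarrow> indep x (x \<cdot> y)"
  using mult_notin[of x y] by (auto simp: indep_def)

lemma indep_mult': "indep x y \<Longrightarrow> indep y (x \<cdot> y)"
  using indep_mult[OF indep_sym, of x y] comm[of x y] by (simp add: indep_def)

text \<open>Four lines meeting only in \<open>e\<close> have 1 + 4 * 2 = 9 points.\<close>

lemma exhaust_by_pairs:
  assumes "indep x y" "indep x z" "indep y z" "indep x w" "indep y w" "indep z w"
  shows "Q = {e, x, sq x, y, sq y, z, sq z, w, sq w}"
proof -
  have "card {e, x, sq x, y, sq y, z, sq z, w, sq w} = 9"
    using assms[THEN indepD(1)] assms[THEN indepD(2)] assms[THEN indepD(3)] assms[THEN indepD(4)]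
      assms[THEN indepD(5)] assms[THEN indepD(7)] assms[THEN indepD(8)] assms[THEN indepD(9)]
    by auto
  then show ?thesis
    using card_subset_eq[OF fin, of "{e, x, sq x, y, sq y, z, sq z, w, sq w}"] card9
      assms[THEN indepD(1)] assms[THEN indepD(2)]
    by auto
qed

text \<open>If both products were \<open>w\<close>, the factorizations of \<open>w\<close> by
  elements of the lines of \<open>x\<close>, \<open>y\<close>, \<open>w\<close> would stay within
  these lines. A point \<open>z\<close> on the fourth line would then need its cofactor in
  \<open>{z, sq z}\<close>, but \<open>z \<cdot> z\<close> and \<open>z \<cdot> sq z\<close> both
  differ from \<open>w\<close>.\<close>

lemma mult_ne_mult_sq:
  assumes "indep x y"
  shows "x \<cdot> y \<noteq> sq x \<cdot> sq y"
proof
  assume eq: "x \<cdot> y = sq x \<cdot> sq y"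
  define w where "w = x \<cdot> y"
  note d = indepD[OF assms]
  have xw: "indep x w" and yw: "indep y w"
    using indep_mult[OF assms] indep_mult'[OF assms] by (simp_all add: w_def)
  have "card {e, x, sq x, y, sq y, w, sq w} \<le> 7"
    using card_length[of "[e, x, sq x, y, sq y, w, sq w]"] by simp
  then have "\<not> Q \<subseteq> {e, x, sq x, y, sq y, w, sq w}"
    using card_mono[of "{e, x, sq x, y, sq y, w, sq w}" Q] card9 by auto
  then obtain z where z: "z \<in> Q" "z \<notin> {e, x, sq x, y, sq y, w, sq w}"
    by blast
  have w: "w \<in> Q" "w \<noteq> e"
    using indepD[OF xw] by auto
  have ind: "indep x z" "indep y z" "indep z w"
    using z d w by (auto simp: indep_def)
  obtain u where u: "u \<in> Q" "z \<cdot> u = w"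
    using division z w by blast
  have "\<exists>t \<in> {e, x, sq x, y, sq y, w, sq w}. t \<cdot> u = w" if "u \<notin> {z, sq z}"
  proof -
    have "y \<cdot> x = w" "sq y \<cdot> sq x = w" "x \<cdot> y = w" "sq x \<cdot> sq y = w"
      using eq comm[of x y] comm[of "sq x" "sq y"] d by (simp_all add: w_def)
    moreover have "w \<cdot> e = w" "e \<cdot> w = w" "sq w \<cdot> sq w = w"
      using w by (simp_all flip: sq_def)
    moreover have "u \<in> {e, x, sq x, y, sq y, w, sq w}"
      using that exhaust_by_pairs[OF assms ind(1,2) xw yw ind(3)] u(1) by simp
    ultimately show ?thesis by blast
  qed
  then have "u \<in> {z, sq z}"
    using u z d w cancel_right[of u z] by (metis insert_iff empty_iff sq_closed e_closed)
  then show False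
    using u(2) z w by (auto simp flip: sq_def)
qed

lemma products_exhaust:
  assumes "indep x y"
  shows "Q = {e, x, sq x, y, sq y, x \<cdot> y, sq x \<cdot> y, x \<cdot> sq y, sq x \<cdot> sq y}"
proof -
  note d = indepD[OF assms]
  define p q r s where pqrs: "p = x \<cdot> y" "q = sq x \<cdot> y" "r = x \<cdot> sq y" "s = sq x \<cdot> sq y"
  have "p \<notin> {e, x, sq x, y, sq y}" "q \<notin> {e, x, sq x, y, sq y}"
    "r \<notin> {e, x, sq x, y, sq y}" "s \<notin> {e, x, sq x, y, sq y}"
    using mult_notin[OF assms] mult_notin[OF indep_sq(1)[OF assms]]
      mult_notin[OF indep_sq(2)[OF assms]] mult_notin[OF indep_sq(1)[OF indep_sq(2)[OF assms]]] d
    by (auto simp: pqrs)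
  \<comment> \<open>Products sharing a factor differ by cancellation; the pairs \<open>p, s\<close>
    and \<open>q, r\<close> need \<open>mult_ne_mult_sq\<close>.\<close>
  moreover have "p \<noteq> q" "p \<noteq> r" "p \<noteq> s" "q \<noteq> r" "q \<noteq> s" "r \<noteq> s"
    using mult_ne_mult_sq[OF assms] mult_ne_mult_sq[OF indep_sq(1)[OF assms]] d
    by (simp_all add: pqrs)
  ultimately have "card {e, x, sq x, y, sq y, p, q, r, s} = 9"
    using d by auto
  moreover have "{e, x, sq x, y, sq y, p, q, r, s} \<subseteq> Q"
    using d by (simp add: pqrs)
  ultimately show ?thesis
    unfolding pqrs[symmetric] using card_subset_eq[OF fin] card9 by metis
qed

text \<open>By elimination among the nine elements. For instance,
  \<open>sq p = sq x \<cdot> y\<close> would turn the Jordan identity into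
  \<open>sq x \<cdot> p = x \<cdot> sq p\<close>, contrary to
  \<open>mult_ne_mult_sq\<close>.\<close>

lemma sq_mult:
  assumes "indep x y"
  shows "sq (x \<cdot> y) = sq x \<cdot> sq y"
proof -
  note d = indepD[OF assms]
  define p where "p = x \<cdot> y"
  have xp: "indep x p" and yp: "indep y p"
    using indep_mult[OF assms] indep_mult'[OF assms] by (simp_all add: p_def)
  have "sq p \<in> {e, x, sq x, y, sq y, p, sq x \<cdot> y, x \<cdot> sq y, sq x \<cdot> sq y}"
    using equalityD1[OF products_exhaust[OF assms]] sq_closed[OF indepD(2)[OF xp]]
    unfolding p_def by (rule subsetD)
  moreover have "sq p \<notin> {e, x, sq x, y, sq y, p}"
    using indepD[OF xp] indepD[OF yp] by auto
  moreover have "sq p \<noteq> sq x \<cdot> y"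
    using jordan[of x y] mult_ne_mult_sq[OF indep_sq(1)[OF xp]] d by (auto simp: p_def)
  moreover have "sq p \<noteq> x \<cdot> sq y"
    using jordan[of y x] mult_ne_mult_sq[OF indep_sq(1)[OF yp]] d comm[of x y] comm[of x "sq y"]
    by (auto simp: p_def)
  ultimately show ?thesis by (auto simp: p_def)
qed

lemma exhaust:
  assumes "indep x y" "z \<in> Q"
  shows "z \<in> {e, x, sq x, y, sq y, x \<cdot> y, sq (x \<cdot> y), sq x \<cdot> y, sq (sq x \<cdot> y)}"
  using subsetD[OF equalityD1[OF products_exhaust[OF assms(1)]] assms(2)]
    sq_mult[OF assms(1)] sq_mult[OF indep_sq(1)[OF assms(1)]] indepD(1)[OF assms(1)]
  by auto

text \<open>Elimination leaves only \<open>y\<close> and \<open>sq y\<close> as values of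
  \<open>sq x \<cdot> p\<close>. The value \<open>sq y\<close> would force
  \<open>x \<cdot> p = q\<close>, and the Jordan identity at \<open>p\<close> would give
  \<open>sq x \<cdot> q = sq q\<close>, hence \<open>q = sq x\<close>.\<close>

lemma inverse_property:
  assumes "indep x y"
  shows "sq x \<cdot> (x \<cdot> y) = y"
proof (rule ccontr)
  assume ne: "sq x \<cdot> (x \<cdot> y) \<noteq> y"
  note d = indepD[OF assms]
  define p where "p = x \<cdot> y"
  define q where "q = sq x \<cdot> y"
  have xp: "indep x p" and xq: "indep (sq x) q"
    using indep_mult[OF assms] indep_mult[OF indep_sq(1)[OF assms]] by (simp_all add: p_def q_def)
  note dp = indepD[OF xp] and dq = indepD[OF xq]
  have sq_q: "sq q = x \<cdot> sq y"
    using sq_mult[OF indep_sq(1)[OF assms]] d by (simp add: q_def)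
  have j: "sq x \<cdot> p = x \<cdot> q"
    using jordan d by (simp add: p_def q_def)
  have "sq x \<cdot> p \<notin> {e, x, sq x, p, sq p}"
    using mult_notin[OF indep_sq(1)[OF xp]] d by auto
  moreover have "sq x \<cdot> p \<notin> {q, sq q}"
    using mult_notin[OF indep_sq(1)[OF xq]] d j by auto
  ultimately have u: "sq x \<cdot> p = sq y"
    using exhaust[OF assms, of "sq x \<cdot> p"] d dp ne by (auto simp flip: p_def q_def)
  have "x \<cdot> p \<notin> {e, x, sq x, p, sq p}"
    using mult_notin[OF xp] by simp
  moreover have "x \<cdot> sq p = y"
    using sq_mult[OF indep_sq(1)[OF xp]] u d by simp
  \<comment> \<open>The values \<open>y\<close> and \<open>sq y\<close> are already taken by
    \<open>x \<cdot> sq p\<close> and \<open>sq x \<cdot> p\<close>.\<close>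
  then have "x \<cdot> p \<noteq> y"
    using dp by (metis cancel sq_closed sq_eq_self)
  moreover have "x \<cdot> p \<noteq> sq y"
    using u dp by (metis cancel_right sq_closed sq_eq_self)
  moreover have "x \<cdot> p \<noteq> sq q"
    using sq_q mult_notin[OF assms] d dp by (auto simp: p_def)
  ultimately have xp_q: "x \<cdot> p = q"
    using exhaust[OF assms, of "x \<cdot> p"] d dp by (auto simp flip: p_def q_def)
  have "sq x \<cdot> q = sq q"
    using jordan[of x p] xp_q u sq_q d dp by simp
  then show False
    using dq by (simp add: mult_eq_sq)
qed

text \<open>Again by elimination: the inverse property recovers \<open>p\<close> from
  \<open>x \<cdot> p\<close>, which rules out \<open>y\<close> and \<open>sq y\<close>.\<close>

lemma alternative:
  assumes "indep x y"
  shows "x \<cdot> (x \<cdot> y) = sq x \<cdot> y"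
proof -
  note d = indepD[OF assms]
  define p where "p = x \<cdot> y"
  define q where "q = sq x \<cdot> y"
  have xp: "indep x p"
    using indep_mult[OF assms] by (simp add: p_def)
  note dp = indepD[OF xp]
  have "x \<cdot> p \<notin> {e, x, sq x, p, sq p}"
    using mult_notin[OF xp] by simp
  moreover have ip: "sq x \<cdot> (x \<cdot> p) = p"
    using inverse_property[OF xp] .
  then have "x \<cdot> p \<noteq> y"
    using d by (auto simp: p_def)
  moreover have "x \<cdot> p \<noteq> sq y"
    using ip sq_mult[OF assms] dp by (auto simp flip: p_def)
  moreover have "x \<cdot> p \<noteq> sq q"
    using sq_mult[OF indep_sq(1)[OF assms]] mult_notin[OF assms] d dp by (auto simp: p_def q_def)
  ultimately show ?thesis
    using exhaust[OF assms, of "x \<cdot> p"] d dp by (auto simp: p_def q_def)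
qed

text \<open>The lines of \<open>p\<close> and \<open>q\<close> are excluded, and \<open>x\<close>,
  \<open>sq x\<close>, \<open>y\<close> are the products \<open>p \<cdot> sq y\<close>,
  \<open>sq y \<cdot> q\<close>, \<open>p \<cdot> sq x\<close>; only \<open>sq y\<close> is
  left.\<close>

lemma mult_of_products:
  assumes "indep x y"
  shows "(x \<cdot> y) \<cdot> (sq x \<cdot> y) = sq y"
proof -
  note d = indepD[OF assms]
  define p where "p = x \<cdot> y"
  define q where "q = sq x \<cdot> y"
  have xp: "indep x p" and xq: "indep (sq x) q" and yp: "indep y p" and yq: "indep y q"
    using indep_mult[OF assms] indep_mult[OF indep_sq(1)[OF assms]]
      indep_mult'[OF assms] indep_mult'[OF indep_sq(1)[OF assms]]
    by (simp_all add: p_def q_def)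
  note dp = indepD[OF xp] indepD[OF yp] and dq = indepD[OF xq] indepD[OF yq]
  have "indep p q"
    using dp dq d sq_mult[OF assms] by (auto simp: indep_def p_def q_def)
  then have "p \<cdot> q \<notin> {e, p, sq p, q, sq q}"
    by (rule mult_notin)
  moreover have "p \<cdot> sq y = x"
    using inverse_property[OF indep_sym[OF assms]] d comm by (simp add: p_def)
  then have "p \<cdot> q \<noteq> x"
    using dp dq d by (metis cancel sq_closed)
  moreover have "sq y \<cdot> q = sq x"
    using inverse_property[OF indep_sym[OF indep_sq(1)[OF assms]]] d comm[of y "sq x"]
    by (simp add: q_def)
  then have "p \<cdot> q \<noteq> sq x"
    using dp dq d by (metis cancel_right sq_closed)
  moreover have "p \<cdot> sq x = y"
    using inverse_property[OF assms] d comm[of "sq x" p] by (simp add: p_def)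
  then have "p \<cdot> q \<noteq> y"
    using dp dq d by (metis cancel sq_closed)
  ultimately show ?thesis
    using exhaust[OF assms, of "p \<cdot> q"] dp dq by (auto simp: p_def q_def)
qed

section \<open>Associativity in exponent 3\<close>

lemma line_or_indep:
  assumes "x \<in> Q" "y \<in> Q"
  obtains "x = e" | "y = e" | "y = x" | "y = sq x" | "indep x y"
  using assms by (auto simp: indep_def)

lemma left_inverse_property:
  assumes "x \<in> Q" "y \<in> Q"
  shows "sq x \<cdot> (x \<cdot> y) = y" and "x \<cdot> (sq x \<cdot> y) = y"
proof -
  show "sq x \<cdot> (x \<cdot> y) = y"
    using assms
    by (cases rule: line_or_indep[OF assms]) (simp_all add: inverse_property flip: sq_def)
  then show "x \<cdot> (sq x \<cdot> y) = y"
    using assms jordan by simp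
qed

lemma left_alternative:
  assumes "x \<in> Q" "y \<in> Q"
  shows "x \<cdot> (x \<cdot> y) = sq x \<cdot> y"
  using assms
  by (cases rule: line_or_indep[OF assms]) (simp_all add: alternative mult_eq_sq flip: sq_def)

text \<open>For each of the nine \<open>z\<close> listed by \<open>exhaust\<close>, the table
  entries collected here evaluate both sides.\<close>

lemma assoc_indep:
  assumes "indep x y" "z \<in> Q"
  shows "(x \<cdot> y) \<cdot> z = x \<cdot> (y \<cdot> z)"
proof -
  note d = indepD[OF assms(1)]
  have yx: "y \<cdot> x = x \<cdot> y" and ysx: "y \<cdot> sq x = sq x \<cdot> y" and syx: "sq y \<cdot> x = x \<cdot> sq y"
    using comm d by simp_all
  have sq_p: "sq (x \<cdot> y) = sq x \<cdot> sq y" and sq_q: "sq (sq x \<cdot> y) = x \<cdot> sq y"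
    using sq_mult[OF assms(1)] sq_mult[OF indep_sq(1)[OF assms(1)]] d by simp_all
  have pq: "(x \<cdot> y) \<cdot> (sq x \<cdot> y) = sq y" and pq': "(x \<cdot> y) \<cdot> (x \<cdot> sq y) = sq x"
    using mult_of_products[OF assms(1)] mult_of_products[OF indep_sym[OF assms(1)]] yx syx by simp_all
  have psp: "(x \<cdot> y) \<cdot> (sq x \<cdot> sq y) = e"
    using cube'(1)[of "x \<cdot> y"] sq_p d by simp
  have px: "(x \<cdot> y) \<cdot> x = sq x \<cdot> y" and py: "(x \<cdot> y) \<cdot> y = x \<cdot> sq y"
    and px': "(x \<cdot> y) \<cdot> sq x = y" and py': "(x \<cdot> y) \<cdot> sq y = x"
    using left_alternative[of x y] left_alternative[of y x] left_inverse_property(1)[of x y]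
      left_inverse_property(1)[of y x] comm d by simp_all
  have y_p: "y \<cdot> (x \<cdot> y) = x \<cdot> sq y" and y_q: "y \<cdot> (sq x \<cdot> y) = sq x \<cdot> sq y"
    and y_sp: "y \<cdot> (sq x \<cdot> sq y) = sq x" and y_sq: "y \<cdot> (x \<cdot> sq y) = x"
    using left_alternative[of y x] left_alternative[of y "sq x"] left_inverse_property(2)[of y x]
      left_inverse_property(2)[of y "sq x"] comm d by simp_all
  show ?thesis
    using exhaust[OF assms] d
    by (auto simp: psp px py px' py' y_p y_q y_sp y_sq yx ysx pq pq' sq_p sq_q left_alternative
        left_inverse_property simp flip: sq_def)
qed

text \<open>For \<open>x\<close>, \<open>y\<close> on a common line this is trivial or the left
  alternative or left inverse law.\<close>

lemma assoc:
  assumes "x \<in> Q" "y \<in> Q" "z \<in> Q"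
  shows "(x \<cdot> y) \<cdot> z = x \<cdot> (y \<cdot> z)"
  using assms
  by (cases rule: line_or_indep[OF assms(1,2)])
    (simp_all add: assoc_indep left_alternative left_inverse_property flip: sq_def)

end

theorem theorem3p9:
  fixes Q :: "'a set" and mult :: "'a \<Rightarrow> 'a \<Rightarrow> 'a" and e :: 'a
  assumes "jordan_loop Q mult e"
    and "finite Q" and "card Q = 9"
  shows "\<forall>x\<in>Q. \<forall>y\<in>Q. \<forall>z\<in>Q. mult (mult x y) z = mult x (mult y z)"
proof -
  interpret jordan_loop_9 Q mult e
    using assms by unfold_locales
  show ?thesis
  proof (cases "\<exists>x\<in>Q. period x = 9")
    case True
    then show ?thesis using assoc_of_period_9 by blast
  next
    case False
    then interpret jordan_loop_9_exponent_3 Q mult e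
      using cube_eq_e by unfold_locales blast
    show ?thesis using assoc by blast
  qed
qed

end
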